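(* Let $q$ be a prime power with $q \equiv 3 \pmod 8$, and let $c \in \mathbb{F}_{q^2}$ be such that $\left(\frac{c}{2}\right)^{\frac{q+1}{4}}=1$. Let $r$ be a positive integer, let $u=\frac{q+5}{4}$, and let $k$ be an even integer such that the exponents $u+k$ and $qu+k+2$ are nonnegative. Let $$h(x)=c+x^{u+k}+x^{qu+k+2}\in\mathbb{F}_{q^2}[x].$$ Then the polynomial $f(x)=x^r h(x^{q-1})$ is a permutation polynomial of $\mathbb{F}_{q^2}$ if and only if $\gcd\left(r,\frac{q^2-1}{4}\right)=1$ and $\gcd\left(r-k-1,\frac{q+1}{4}\right)=1$.
   Context: $\mathbb{F}_{q^2}$ denotes the finite field with $q^2$ elements. A polynomial $f\in\mathbb{F}_{q^2}[x]$ is a permutation polynomial of $\mathbb{F}_{q^2}$ if the map $a\mapsto f(a)$ from $\mathbb{F}_{q^2}$ to itself is a bijection. *)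

theory Defs
  imports
    "HOL-Computational_Algebra.Polynomial"
    "HOL-Library.Cardinality"
    "HOL-Number_Theory.Cong"
    "HOL-Number_Theory.Prime_Powers"
begin

definition permutation_poly :: "'a::{field,finite} poly \<Rightarrow> bool"
  where "permutation_poly f \<longleftrightarrow> bij (poly f)"

end

theory Submission
  imports Defs
begin

text \<open>
  Write \<open>q + 1 = 4m\<close> with \<open>m\<close> odd and \<open>c = 2\<gamma>\<close> with \<open>\<gamma>\<^sup>m = 1\<close>. On the group of
  \<open>(q+1)\<close>-st roots of unity \<open>h(x) = 2\<gamma> + x\<^bsup>k+1\<^esup> (x\<^sup>m + x\<^bsup>-m\<^esup>)\<close>, where \<open>x\<^sup>m\<close> is a fourth
  root of unity. If \<open>x\<^bsup>2m\<^esup> = -1\<close> then \<open>h(x) = 2\<gamma>\<close>; if \<open>x\<^bsup>2m\<^esup> = 1\<close> then \<open>h(x) = 2(\<gamma> + w)\<close>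
  with \<open>w = x\<^bsup>m+k+1\<^esup>\<close>, which does not vanish since \<open>w\<^sup>m = \<gamma>\<^sup>m = 1\<close> and \<open>m\<close> is odd. Hence
  \<open>f(a)\<^bsup>q-1\<^esup>\<close>, as a function of \<open>x = a\<^bsup>q-1\<^esup>\<close>, equals the monomial \<open>\<gamma>\<^bsup>-2\<^esup> x\<^sup>r\<close> on the first
  part and \<open>\<gamma>\<^bsup>-1\<^esup> x\<^bsup>r-k-1+m\<^esup>\<close> on the second, and both gcd conditions can be read off.
\<close>

section \<open>Coprimality and integer exponents in a field\<close>

lemma not_coprime_obtain_prime:
  fixes a b :: "'a::factorial_semiring"
  assumes "\<not> coprime a b" "b \<noteq> 0"
  obtains p where "prime p" "p dvd a" "p dvd b"
proof -
  obtain c where c: "c dvd a" "c dvd b" "\<not> is_unit c"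
    using assms(1) by (rule not_coprimeE)
  moreover have "c \<noteq> 0"
    using c(2) assms(2) by auto
  ultimately obtain p where "p dvd c" "prime p"
    using prime_divisor_exists by blast
  with c that show thesis
    using dvd_trans by blast
qed

lemma power_int_eq_1_coprime:
  fixes z :: "'a::field"
  assumes "z \<noteq> 0" "z powi a = 1" "z powi b = 1" "coprime a b"
  shows "z = 1"
proof -
  obtain u v where "u * a + v * b = 1"
    using bezout_int[of a b] assms(4) by auto
  then have "z = z powi (a * u + b * v)"
    by (simp add: mult.commute)
  also have "\<dots> = (z powi a) powi u * (z powi b) powi v"
    using assms(1) by (simp add: power_int_add power_int_mult)
  finally show ?thesis
    using assms by simp
qed

text \<open>The quotient \<open>x / y\<close> has two coprime powers equal to 1. All coprimality
  hypotheses become injectivity through this form.\<close>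

lemma power_int_inj_coprime:
  fixes x y :: "'a::field"
  assumes "x \<noteq> 0" "y \<noteq> 0" "x powi a = y powi a" "x powi b = y powi b" "coprime a b"
  shows "x = y"
proof -
  have "x / y = 1"
    by (rule power_int_eq_1_coprime[of _ a b]) (use assms in \<open>auto simp: power_int_divide_distrib\<close>)
  then show ?thesis
    using assms by simp
qed

section \<open>Roots of unity and characteristic of a finite field\<close>

lemma power_card_minus_1_eq_1:
  fixes x :: "'a::{field,finite}"
  assumes "x \<noteq> 0"
  shows "x ^ (CARD('a) - 1) = 1"
proof -
  \<comment> \<open>Multiplication by \<open>x\<close> permutes the nonzero elements, whose product
    is nonzero and can be cancelled.\<close>
  have "(\<Prod>y\<in>UNIV-{0}. x * y) = (\<Prod>y\<in>UNIV-{0}. y)"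
    by (rule prod.reindex_bij_witness[of _ "\<lambda>y. y / x" "\<lambda>y. x * y"]) (use assms in auto)
  then show ?thesis
    by (simp add: prod.distrib)
qed

text \<open>Otherwise \<open>monom 1 n - 1\<close> would have more roots than its degree. This bound
  stands in for cyclicity of the multiplicative group.\<close>

lemma exists_power_neq_1:
  assumes "0 < n" "n < CARD('a::{field,finite}) - 1"
  shows "\<exists>x::'a. x \<noteq> 0 \<and> x ^ n \<noteq> 1"
proof (rule ccontr)
  assume *: "\<not> ?thesis"
  define p :: "'a poly" where "p = monom 1 n - 1"
  have "coeff p n = 1"
    using assms(1) by (simp add: p_def)
  then have "p \<noteq> 0"
    by auto
  have "CARD('a) - 1 = card (UNIV - {0::'a})"
    by simp
  also have "\<dots> \<le> card {x. poly p x = 0}"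
    using * by (intro card_mono) (auto simp: p_def poly_monom)
  also have "\<dots> \<le> degree p"
    using \<open>p \<noteq> 0\<close> by (rule card_poly_roots_bound)
  also have "\<dots> \<le> n"
    unfolding p_def by (rule degree_diff_le) (auto simp: degree_monom_le)
  finally show False
    using assms(2) by simp
qed

text \<open>Cauchy's theorem for the multiplicative group: take the power with exponent
  \<open>(CARD('a) - 1) / p\<close> of an element for which it is not 1.\<close>

lemma exists_root_of_unity_prime:
  assumes "prime p" "p dvd CARD('a::{field,finite}) - 1" "CARD('a) > 2"
  shows "\<exists>z::'a. z \<noteq> 0 \<and> z \<noteq> 1 \<and> z ^ p = 1"
proof -
  obtain n where n: "CARD('a) - 1 = n * p"
    using assms(2) by (metis dvd_def mult.commute)
  have "0 < n"
    using n assms(3) by (cases n) auto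
  moreover have "n < CARD('a) - 1"
    using n \<open>0 < n\<close> prime_gt_1_nat[OF assms(1)] by simp
  ultimately obtain x :: 'a where x: "x \<noteq> 0" "x ^ n \<noteq> 1"
    using exists_power_neq_1 by blast
  then have "(x ^ n) ^ p = 1"
    using power_card_minus_1_eq_1[of x] n by (simp add: power_mult)
  then show ?thesis
    using x by (intro exI[of _ "x ^ n"]) auto
qed

text \<open>Translation by 1 permutes the ring, so comparing the sums over all elements gives
  \<open>of_nat CARD('a) = 0\<close>.\<close>

lemma CHAR_dvd_CARD_finite: "CHAR('a::{ring_1,finite}) dvd CARD('a)"
proof -
  have "(\<Sum>x\<in>UNIV. x + 1) = (\<Sum>x\<in>UNIV. x :: 'a)"
    by (rule sum.reindex_bij_witness[of _ "\<lambda>x. x - 1" "\<lambda>x. x + 1"]) auto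
  then have "of_nat CARD('a) = (0::'a)"
    by (simp add: sum.distrib)
  then show ?thesis
    by (simp add: of_nat_eq_0_iff_char_dvd)
qed

lemma CHAR_eq_of_card_prime_power:
  assumes "prime p" "CARD('a::{field,finite}) = p ^ n"
  shows "CHAR('a) = p"
proof -
  have "CHAR('a) > 0"
    by (rule finite_imp_CHAR_pos) simp
  then have "prime CHAR('a)"
    by (rule prime_CHAR_semidom)
  moreover have "CHAR('a) dvd p ^ n"
    using CHAR_dvd_CARD_finite[where 'a='a] assms(2) by simp
  ultimately show ?thesis
    using assms(1) prime_dvd_power primes_dvd_imp_eq by blast
qed

section \<open>Setting: arithmetic of \<open>q\<close> and \<open>m\<close>, Frobenius\<close>

locale permutation_setup =
  fixes q m r :: nat and k :: int and \<gamma> :: "'a::{field,finite}"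
  assumes q_primepow: "primepow q"
    and q_m: "q + 1 = 4 * m"
    and odd_m: "odd m"
    and card_q: "CARD('a) = q ^ 2"
    and \<gamma>_m: "\<gamma> ^ m = 1"
    and even_k: "even k"
    and r_pos: "r > 0"
begin

text \<open>This is h with exponents reduced modulo q + 1 = 4m, so it represents h only on (q+1)-st
  roots of unity. Integer powers allow the reduced exponents to be negative.\<close>

definition H :: "'a \<Rightarrow> 'a" where
  "H x = 2 * \<gamma> + x powi (k + 1 + int m) + x powi (k + 1 - int m)"

definition F :: "'a \<Rightarrow> 'a" where
  "F a = a ^ r * H (a ^ (q - 1))"

lemma m_pos: "m > 0"
  using odd_m by (rule odd_pos)

lemma q_ge_3: "q \<ge> 3"
  using q_m m_pos by linarith

lemma q_minus_1_m: "q ^ 2 - 1 = (q - 1) * (4 * m)"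
  unfolding q_m[symmetric] by (simp add: power2_eq_square algebra_simps)

lemma q_minus_1: "q - 1 = 2 * (2 * m - 1)"
  using q_m by simp

lemma card_minus_1: "CARD('a) - 1 = (q - 1) * (4 * m)"
  unfolding card_q q_minus_1_m ..

lemma card_gt_2: "CARD('a) > 2"
  using q_ge_3 power_mono[of 3 q 2] by (simp add: card_q)

lemma card_div_4: "(q ^ 2 - 1) div 4 = (q - 1) * m"
  unfolding q_minus_1_m by simp

lemma coprime_q_minus_1_m: "coprime (q - 1) m"
proof -
  have "coprime (2 * m - 1) m"
    using m_pos by (metis coprime_diff_one_left_nat coprime_mult_right_iff mult_pos_pos pos2)
  then show ?thesis
    unfolding q_minus_1 using odd_m by simp
qed

lemma odd_q: "odd q"
  using q_m by (metis dvd_triv_left even_add even_mult_iff even_numeral odd_one)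

lemma frobenius: "(x + y) ^ q = x ^ q + (y::'a) ^ q"
  and two_nonzero: "(2::'a) \<noteq> 0"
  and two_power: "(2::'a) ^ q = 2"
proof -
  obtain p n where pn: "prime p" "n > 0" "q = p ^ n"
    using q_primepow by (auto simp: primepow_def)
  then have char: "CHAR('a) = p"
    by (intro CHAR_eq_of_card_prime_power[of p "n * 2"]) (auto simp: card_q power_mult)
  show frob: "(x + y) ^ q = x ^ q + y ^ q" for x y :: 'a
    using pn char by (intro freshmans_dream') auto
  from frob[of 1 1] show "(2::'a) ^ q = 2"
    by simp
  have "\<not> p dvd 2"
    using odd_q pn by (metis dvd_power even_power primes_dvd_imp_eq two_is_prime_nat)
  then show "(2::'a) \<noteq> 0"
    using of_nat_eq_0_iff_char_dvd[where 'a='a, of 2] char by simp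
qed

lemma one_neq_minus_one: "(1::'a) \<noteq> -1"
  using two_nonzero by (metis add.right_inverse one_add_one)

lemma \<gamma>_nonzero: "\<gamma> \<noteq> 0"
  using \<gamma>_m m_pos by (auto simp: power_0_left)

lemma power_unit: "a \<noteq> 0 \<Longrightarrow> (a ^ (q - 1)) ^ (4 * m) = (1::'a)"
  using power_card_minus_1_eq_1[of a] unfolding card_q q_minus_1_m power_mult .

text \<open>Frobenius acts as inversion on (q+1)-st roots of unity.\<close>

lemma power_q_times_self: "x ^ (4 * m) = 1 \<Longrightarrow> x ^ q * x = (1::'a)"
  unfolding q_m[symmetric] by (simp add: mult.commute)

lemma power_q_split: "x ^ q = x ^ (q - 1) * (x::'a)"
  using q_ge_3 by (metis Suc_pred' mult.commute not_less_eq_eq not_numeral_le_zero power_Suc zero_less_iff_neq_zero)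

section \<open>Values of h on (q+1)-st roots of unity\<close>

lemma power_int_2m:
  assumes "x ^ (2 * m) = (1::'a)" "2 * int m dvd n"
  shows "x powi n = 1"
proof -
  obtain t where "n = int (2 * m) * t"
    using assms(2) by auto
  then have "x powi n = (x ^ (2 * m)) powi t"
    by (simp only: power_int_mult power_int_of_nat)
  then show ?thesis
    using assms(1) by simp
qed

text \<open>The two exponents differ by 2m, so the two powers of \<open>x\<close> cancel here; when
  \<open>x ^ (2 * m) = 1\<close> they coincide instead.\<close>

lemma H_of_minus_1:
  assumes "x ^ (2 * m) = -1"
  shows "H x = 2 * \<gamma>"
proof -
  have x: "x \<noteq> 0"
    using assms m_pos by (auto simp: power_0_left)
  have "x powi (k + 1 + int m) = x powi (int (2 * m) + (k + 1 - int m))"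
    by (rule arg_cong[of _ _ "power_int x"]) simp
  also have "\<dots> = - (x powi (k + 1 - int m))"
    by (simp only: power_int_add[OF disjI1[OF x]] power_int_of_nat assms) simp
  finally show ?thesis
    by (simp add: H_def)
qed

lemma H_of_1:
  assumes "x ^ (2 * m) = 1"
  shows "H x = 2 * (\<gamma> + x powi (k + 1 + int m))"
proof -
  have x: "x \<noteq> 0"
    using assms m_pos by (auto simp: power_0_left)
  have "x powi (k + 1 + int m) = x powi (int (2 * m) + (k + 1 - int m))"
    by (rule arg_cong[of _ _ "power_int x"]) simp
  also have "\<dots> = x powi (k + 1 - int m)"
    by (simp only: power_int_add[OF disjI1[OF x]] power_int_of_nat assms) simp
  finally show ?thesis
    by (simp add: H_def algebra_simps)
qed

lemma H_of_1_nonzero: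
  assumes "x ^ (2 * m) = 1"
  shows "H x \<noteq> 0"
proof
  assume "H x = 0"
  then have "\<gamma> = - (x powi (k + 1 + int m))"
    using H_of_1[OF assms] two_nonzero by (metis eq_neg_iff_add_eq_0 mult_eq_0_iff)
  then have "\<gamma> ^ m = - (x powi ((k + 1 + int m) * int m))"
    using odd_m by (simp add: power_minus_odd power_int_power')
  \<comment> \<open>Evenness makes \<open>(k + 1 + int m) * int m\<close> a multiple of 2m.\<close>
  moreover have "even (k + 1 + int m)"
    using odd_m even_k by simp
  then have "x powi ((k + 1 + int m) * int m) = 1"
    by (intro power_int_2m[OF assms] mult_dvd_mono) auto
  ultimately show False
    using \<gamma>_m one_neq_minus_one by simp
qed

lemma power_2m_cases:
  assumes "a \<noteq> (0::'a)"
  shows "(a ^ (q - 1)) ^ (2 * m) = 1 \<or> (a ^ (q - 1)) ^ (2 * m) = -1"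
proof -
  have "((a ^ (q - 1)) ^ (2 * m)) ^ 2 = 1"
    using power_unit[OF assms] by (simp flip: power_mult add: mult_ac)
  then show ?thesis
    by (simp add: power2_eq_1_iff)
qed

lemma H_nonzero:
  assumes "a \<noteq> 0"
  shows "H (a ^ (q - 1)) \<noteq> 0"
  using power_2m_cases[OF assms] H_of_1_nonzero H_of_minus_1 two_nonzero \<gamma>_nonzero by auto

section \<open>The induced map on (q-1)-st powers\<close>

lemma F_eq_0_iff: "F a = 0 \<longleftrightarrow> a = 0"
  using H_nonzero r_pos by (auto simp: F_def power_0_left)

lemma F_power: "F a ^ (q - 1) = (a ^ (q - 1)) ^ r * H (a ^ (q - 1)) ^ (q - 1)"
  by (simp add: F_def power_mult_distrib flip: power_mult) (simp add: mult.commute)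

lemma \<gamma>_power_q: "\<gamma> ^ q * \<gamma> = 1"
  by (rule power_q_times_self) (simp add: mult.commute[of 4] power_mult \<gamma>_m)

text \<open>Here h takes the value 2\<gamma>, and Frobenius fixes 2 and inverts \<gamma>, so its
  (q-1)-st power is the inverse of \<open>\<gamma> ^ 2\<close>.\<close>

lemma F_power_minus_1:
  assumes "(a ^ (q - 1)) ^ (2 * m) = -1"
  shows "F a ^ (q - 1) * \<gamma> ^ 2 = (a ^ (q - 1)) ^ r"
proof -
  have "(2 * \<gamma>) ^ (q - 1) * (2 * \<gamma>) * \<gamma> = 2 * (\<gamma> ^ q * \<gamma>)"
    unfolding power_q_split[symmetric] by (simp add: power_mult_distrib two_power)
  then have "(2 * \<gamma>) ^ (q - 1) * \<gamma> ^ 2 = 1"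
    using two_nonzero \<gamma>_power_q by (simp add: power2_eq_square mult.assoc)
  then show ?thesis
    unfolding F_power H_of_minus_1[OF assms] by (simp add: mult.assoc)
qed

text \<open>Frobenius inverts both \<gamma> and w, hence sends \<gamma> + w to (\<gamma> + w) /
  (\<gamma> w), and the (q-1)-st power of h is 1 / (\<gamma> w). Dividing \<open>x ^ r\<close> by w
  gives the exponent r-k-1-m, which may be raised by 2m.\<close>

lemma F_power_1:
  assumes "a \<noteq> 0" and x: "(a ^ (q - 1)) ^ (2 * m) = 1"
  shows "F a ^ (q - 1) * \<gamma> = (a ^ (q - 1)) powi (int r - k - 1 + int m)"
proof -
  define x where "x = a ^ (q - 1)"
  define w where "w = x powi (k + 1 + int m)"
  have x0: "x \<noteq> 0"
    using assms by (simp add: x_def)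
  have "w ^ (4 * m) = 1"
    unfolding w_def power_int_power' by (rule power_int_2m) (use x in \<open>auto simp: x_def\<close>)
  then have w: "w ^ q * w = 1"
    by (rule power_q_times_self)
  have H: "H x = 2 * (\<gamma> + w)"
    unfolding w_def by (rule H_of_1) (use x in \<open>simp add: x_def\<close>)
  have "H x ^ q * \<gamma> * w = 2 * ((\<gamma> ^ q * \<gamma>) * w + (w ^ q * w) * \<gamma>)"
    unfolding H by (simp add: power_mult_distrib two_power frobenius algebra_simps)
  also have "\<dots> = H x"
    unfolding H w \<gamma>_power_q by (simp add: add.commute)
  finally have "H x ^ (q - 1) * \<gamma> * w = 1"
    unfolding power_q_split using H_nonzero[OF assms(1)] by (simp add: x_def mult_ac)
  then have "F a ^ (q - 1) * \<gamma> * w = x ^ r"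
    unfolding F_power x_def[symmetric] by (simp add: mult.assoc)
  also have "x ^ r = x powi int r * x powi (2 * int m)"
    using power_int_2m[of x] x by (simp add: x_def)
  also have "\<dots> = x powi (int r - k - 1 + int m) * w"
    unfolding w_def power_int_add[OF disjI1[OF x0], symmetric]
    by (rule arg_cong[of _ _ "power_int x"]) simp
  finally show ?thesis
    unfolding x_def[symmetric] using x0 by (simp add: w_def)
qed

section \<open>Necessity of the gcd conditions\<close>

lemma inj_F_imp_coprime_r:
  assumes "inj F"
  shows "coprime r ((q - 1) * m)"
proof (rule ccontr)
  assume "\<not> ?thesis"
  then obtain p where p: "prime p" "p dvd r" "p dvd (q - 1) * m"
    by (rule not_coprime_obtain_prime) (use q_ge_3 m_pos in auto)
  have "p dvd CARD('a) - 1"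
    unfolding card_minus_1 using p(3) by (metis dvd_mult mult.left_commute)
  then obtain z :: 'a where z: "z \<noteq> 0" "z \<noteq> 1" "z ^ p = 1"
    using exists_root_of_unity_prime p(1) card_gt_2 by blast
  have root: "z ^ n = 1" if "p dvd n" for n
    using that z(3) by (auto simp: power_mult)
  consider "p dvd q - 1" | "p dvd m"
    using p by (auto simp: prime_dvd_mult_iff)
  then show False
  proof cases
    case 1
    \<comment> \<open>Both \<open>z ^ r\<close> and \<open>z ^ (q - 1)\<close> equal 1.\<close>
    then have "F z = F 1"
      by (simp add: F_def root p)
    with assms have "z = 1"
      by (rule injD)
    with z(2) show False ..
  next
    case 2
    \<comment> \<open>The collision is sought where h is constant. Since p divides m, multiplying
      \<open>a\<close> by \<open>z\<close> stays in that part, and \<open>z ^ r = 1\<close> leaves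
      the value unchanged.\<close>
    have "2 * ((q - 1) * m) < CARD('a) - 1" "0 < 2 * ((q - 1) * m)"
      unfolding card_minus_1 using q_ge_3 m_pos by simp_all
    then obtain a :: 'a where a: "a \<noteq> 0" "a ^ (2 * ((q - 1) * m)) \<noteq> 1"
      using exists_power_neq_1 by blast
    then have a1: "(a ^ (q - 1)) ^ (2 * m) = -1"
      using power_2m_cases[OF a(1)] by (simp flip: power_mult add: mult_ac)
    have "z ^ ((q - 1) * (2 * m)) = 1"
      using 2 by (intro root) auto
    then have "((a * z) ^ (q - 1)) ^ (2 * m) = -1"
      using a1 by (simp add: power_mult_distrib flip: power_mult)
    then have "F (a * z) = F a"
      using a1 by (simp add: F_def H_of_minus_1 power_mult_distrib root p)
    with assms have "a * z = a"
      by (rule injD)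
    with a z show False
      by simp
  qed
qed

text \<open>For a common prime p, a nontrivial p-th root of unity z gives \<open>F z\<close> and
  \<open>F 1\<close> the same (q-1)-st power. Their quotient s then satisfies
  \<open>s ^ (q - 1) = 1\<close>, and coprimality of r and q - 1 supplies an r-th root t of s of the
  same kind. Rescaling z by t yields the value \<open>F 1\<close>, so injectivity forces t z = 1;
  then z has order dividing both q - 1 and m, which are coprime.\<close>

lemma inj_F_imp_coprime_r_k:
  assumes "inj F" "coprime r (q - 1)"
  shows "coprime (int r - k - 1) (int m)"
proof (rule ccontr)
  assume "\<not> ?thesis"
  then obtain p' where p': "prime p'" "p' dvd int r - k - 1" "p' dvd int m"
    by (rule not_coprime_obtain_prime) (use m_pos in auto)
  then obtain p where "p' = int p"
    using prime_ge_0_int nonneg_int_cases by metis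
  with p' have p: "prime p" "int p dvd int r - k - 1" "p dvd m"
    by simp_all
  have "p dvd CARD('a) - 1"
    unfolding card_minus_1 using p(3) by (intro dvd_mult)
  then obtain z :: 'a where z: "z \<noteq> 0" "z \<noteq> 1" "z ^ p = 1"
    using exists_root_of_unity_prime p(1) card_gt_2 by blast
  have root: "z ^ n = 1" if "p dvd n" for n
    using that z(3) by (auto simp: power_mult)
  have "int p dvd int (q - 1) * (int r - k - 1 + int m)"
    using p by (intro dvd_mult dvd_add) auto
  then have "(z ^ (q - 1)) powi (int r - k - 1 + int m) = 1"
    unfolding power_int_power using z(3)
    by (elim dvdE) (simp only: power_int_mult power_int_of_nat power_int_1_left)
  moreover have "(z ^ (q - 1)) ^ (2 * m) = 1"
    unfolding power_mult[symmetric] using p by (intro root) auto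
  ultimately have "F z ^ (q - 1) * \<gamma> = F 1 ^ (q - 1) * \<gamma>"
    using F_power_1[of z] F_power_1[of 1] z by simp
  then have *: "F z ^ (q - 1) = F 1 ^ (q - 1)"
    using \<gamma>_nonzero by simp
  define s where "s = F 1 / F z"
  have s: "s ^ (q - 1) = 1" "s \<noteq> 0"
    using * z F_eq_0_iff by (simp_all add: s_def power_divide)
  obtain u v where uv: "u * int r + v * int (q - 1) = 1"
    using bezout_int[of "int r" "int (q - 1)"] assms(2) by auto
  define t where "t = s powi u"
  have "s = s powi (u * int r + int (q - 1) * v)"
    using uv by (simp add: mult.commute)
  also have "\<dots> = (s powi u) ^ r * (s ^ (q - 1)) powi v"
    unfolding power_int_add[OF disjI1[OF s(2)]] power_int_mult power_int_of_nat ..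
  finally have tr: "t ^ r = s"
    using s by (simp add: t_def)
  have "t ^ (q - 1) = (s ^ (q - 1)) powi u"
    unfolding t_def power_int_power power_int_power' by (simp only: mult.commute)
  then have tq: "t ^ (q - 1) = 1"
    using s by simp
  have "F (t * z) = s * F z"
    using tq tr by (simp add: F_def power_mult_distrib)
  then have "F (t * z) = F 1"
    using z F_eq_0_iff by (simp add: s_def)
  with assms(1) have tz: "t * z = 1"
    by (rule injD)
  then have "t ^ (q - 1) * z ^ (q - 1) = 1"
    by (simp flip: power_mult_distrib)
  then have "z powi int (q - 1) = 1"
    using tq by (simp only: power_int_of_nat mult_1)
  moreover have "z powi int m = 1"
    using root[OF p(3)] by simp
  ultimately have "z = 1"
    using power_int_eq_1_coprime[of z "int (q - 1)" "int m"] z(1) coprime_q_minus_1_m by simp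
  with z show False
    by simp
qed

section \<open>Sufficiency of the gcd conditions\<close>

lemma coprime_imp_inj_F:
  assumes r: "coprime r ((q - 1) * m)" and rk: "coprime (int r - k - 1) (int m)"
  shows "inj F"
proof
  fix a b
  assume F: "F a = F b"
  show "a = b"
  proof (cases "a = 0 \<or> b = 0")
    case True
    then show ?thesis
      using F F_eq_0_iff by metis
  next
    case False
    then have ab: "a \<noteq> 0" "b \<noteq> 0"
      by auto
    define x y where "x = a ^ (q - 1)" and "y = b ^ (q - 1)"
    have xy: "x \<noteq> 0" "y \<noteq> 0"
      using ab by (auto simp: x_def y_def)
    have rq: "coprime r (q - 1)" and rm: "coprime r m"
      using r by auto
    have "even (q - 1)"
      unfolding q_minus_1 by simp
    then have "odd r"
      using rq coprime_common_divisor[of r "q - 1" 2] by auto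
    define e where "e = int r - k - 1 + int m"
    \<comment> \<open>The left side depends only on \<open>F a\<close>, so equal values of
      \<open>F\<close> force the same sign \<open>x ^ (2 * m)\<close>. On the part with sign -1 this
      rests on \<open>r\<close> being odd.\<close>
    have sgn: "(F a ^ (q - 1) * \<gamma> ^ 2) ^ (2 * m) = x ^ (2 * m)"
      if "a \<noteq> 0" "x = a ^ (q - 1)" for a x
      using power_2m_cases[OF that(1)]
    proof
      assume "(a ^ (q - 1)) ^ (2 * m) = 1"
      then have *: "F a ^ (q - 1) * \<gamma> = x powi e" "x ^ (2 * m) = 1"
        using F_power_1[OF that(1)] that by (auto simp: e_def)
      have "(x powi e) ^ (2 * m) = 1"
        unfolding power_int_power' by (rule power_int_2m[OF *(2)]) simp
      moreover have "\<gamma> ^ (2 * m) = 1"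
        by (simp add: mult.commute[of 2] power_mult \<gamma>_m)
      moreover have "F a ^ (q - 1) * \<gamma> ^ 2 = x powi e * \<gamma>"
        unfolding *(1)[symmetric] by (simp only: power2_eq_square mult.assoc)
      ultimately show ?thesis
        using *(2) by (simp only: power_mult_distrib mult_1)
    next
      assume "(a ^ (q - 1)) ^ (2 * m) = -1"
      then have *: "F a ^ (q - 1) * \<gamma> ^ 2 = x ^ r" "x ^ (2 * m) = -1"
        using F_power_minus_1 that by auto
      have "(x ^ r) ^ (2 * m) = (x ^ (2 * m)) ^ r"
        by (simp add: mult.commute flip: power_mult)
      then show ?thesis
        using * \<open>odd r\<close> by simp
    qed
    have eq: "x ^ (2 * m) = y ^ (2 * m)"
      using sgn[OF ab(1) x_def] sgn[OF ab(2) y_def] F by simp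
    have "x = y"
      using power_2m_cases[OF ab(1)]
    proof
      assume 1: "(a ^ (q - 1)) ^ (2 * m) = 1"
      moreover from this have "(b ^ (q - 1)) ^ (2 * m) = 1"
        using eq by (simp add: x_def y_def)
      ultimately have "x powi e = y powi e"
        using F_power_1[OF ab(1)] F_power_1[OF ab(2)] F by (simp add: x_def y_def e_def)
      moreover have "x powi int (2 * m) = y powi int (2 * m)"
        using eq by (simp only: power_int_of_nat)
      \<comment> \<open>The summand \<open>int m\<close> makes \<open>e\<close> odd, so coprimality
        to m extends to 2m.\<close>
      moreover have "coprime e (int (2 * m))"
      proof -
        have "odd e"
          using \<open>odd r\<close> even_k odd_m by (simp add: e_def)
        moreover have "coprime e (int m)"
          using rk by (simp add: e_def coprime_iff_gcd_eq_1)
        ultimately show ?thesis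
          by simp
      qed
      ultimately show ?thesis
        by (rule power_int_inj_coprime[OF xy])
    next
      assume 1: "(a ^ (q - 1)) ^ (2 * m) = -1"
      moreover from this have "(b ^ (q - 1)) ^ (2 * m) = -1"
        using eq by (simp add: x_def y_def)
      ultimately have "x powi int r = y powi int r"
        using F_power_minus_1[of a] F_power_minus_1[of b] F by (simp add: x_def y_def)
      moreover have "x powi int (2 * m) = y powi int (2 * m)"
        using eq by (simp only: power_int_of_nat)
      moreover have "coprime (int r) (int (2 * m))"
        using rm \<open>odd r\<close> by simp
      ultimately show ?thesis
        by (rule power_int_inj_coprime[OF xy])
    qed
    \<comment> \<open>Once x = y, the nonzero factor \<open>H\<close> cancels, so a and b agree in
      their powers with the coprime exponents r and q - 1.\<close>
    then have "a powi int (q - 1) = b powi int (q - 1)"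
      by (simp only: power_int_of_nat x_def y_def)
    moreover have "a ^ r = b ^ r"
      using F \<open>x = y\<close> H_nonzero[OF ab(2)] by (simp add: F_def x_def y_def)
    then have "a powi int r = b powi int r"
      by simp
    ultimately show ?thesis
      using power_int_inj_coprime[OF ab, of "int r" "int (q - 1)"] rq by simp
  qed
qed

theorem bij_F_iff:
  "bij F \<longleftrightarrow> coprime r ((q - 1) * m) \<and> coprime (int r - k - 1) (int m)"
proof -
  have "bij F \<longleftrightarrow> inj F"
    using finite_UNIV_inj_surj[of F] by (auto simp: bij_def)
  then show ?thesis
    by (meson inj_F_imp_coprime_r inj_F_imp_coprime_r_k coprime_imp_inj_F coprime_mult_right_iff)
qed

end

section \<open>Transfer to the polynomial f\<close>

theorem theorem1p5:
  fixes c :: "'a::{field,finite}"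
    and q r u :: nat
    and k :: int
    and h f :: "'a poly"
  assumes "primepow q"
    and "[q = 3] (mod 8)"
    and "CARD('a) = q ^ 2"
    and "(c / 2) ^ ((q + 1) div 4) = 1"
    and "r > 0"
    and "u = (q + 5) div 4"
    and "even k"
    and "int u + k \<ge> 0"
    and "int (q * u) + k + 2 \<ge> 0"
    and "h = [:c:] + monom 1 (nat (int u + k)) + monom 1 (nat (int (q * u) + k + 2))"
    and "f = monom 1 r * pcompose h (monom 1 (q - 1))"
  shows "permutation_poly f \<longleftrightarrow>
    gcd r ((q ^ 2 - 1) div 4) = 1 \<and> gcd (int r - k - 1) (int ((q + 1) div 4)) = 1"
proof -
  define m where "m = (q + 1) div 4"
  have "q mod 8 = 3"
    using assms(2) by (simp add: cong_def)
  \<comment> \<open>Then m = 2j + 1 is odd, and u = 2j + 2 = m + 1.\<close>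
  then obtain j where "q = 8 * j + 3"
    by (metis div_mult_mod_eq mult.commute)
  then have m: "q + 1 = 4 * m" "odd m" "u = m + 1"
    by (simp_all add: m_def assms(6))
  interpret permutation_setup q m r k "c / 2"
    using assms m by unfold_locales (auto simp: m_def)
  have "poly h x = H x" if x: "x ^ (4 * m) = 1" for x
  proof -
    have x0: "x \<noteq> 0"
      using x m_pos by (auto simp: power_0_left)
    have q: "int q = 4 * int m - 1"
      using m(1) by linarith
    \<comment> \<open>Since q = 4m - 1, the product q u is 4m(m+1) - (m+1), and the multiple of 4m
      drops out of the exponent.\<close>
    then have "int (q * u) + k + 2 = int (4 * m) * (int m + 1) + (k + 1 - int m)"
      unfolding m(3) of_nat_mult q by (simp add: algebra_simps)
    then have "x powi (int (q * u) + k + 2) = x powi (k + 1 - int m)"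
      by (simp only: power_int_add[OF disjI1[OF x0]] power_int_mult[of x "int (4 * m)"]
          power_int_of_nat x) simp
    moreover have "x powi (int u + k) = x powi (k + 1 + int m)"
      by (simp add: m(3) algebra_simps)
    moreover have "2 * (c / 2) = c"
      using two_nonzero by simp
    ultimately show ?thesis
      using assms(8,9) by (simp add: assms(10) H_def poly_monom flip: power_int_nonneg_exp)
  qed
  \<comment> \<open>A nonzero \<open>a\<close> makes \<open>a ^ (q - 1)\<close> a (q+1)-st root of
    unity; at 0 both sides vanish because r is positive.\<close>
  then have "poly f a = F a" for a
    using power_unit[of a] r_pos
    by (cases "a = 0") (simp_all add: assms(11) F_def poly_pcompose poly_monom power_0_left)
  then have "poly f = F"
    by auto
  then show ?thesis
    unfolding permutation_poly_def card_div_4 m_def[symmetric]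
    using bij_F_iff by (simp add: coprime_iff_gcd_eq_1)
qed

end
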